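(* Let $h:\mathbb{R}\to\mathbb{R}$ and $x^\star\in\mathbb{R}$ satisfy Assumptions (A1) and (A2) of the context, and let $\gamma>0$. For $\delta>0$ consider the scalar system $$\dot x_a=-\frac{\gamma}{2}\,b_{1,\delta}(x_a),\qquad b_{1,\delta}(x):=2\int_0^1 h\big(x+\delta\sin(2\pi t)\big)\sin(2\pi t)\,dt. \qquad (\ast)$$ Then: (a) For all $\delta>0$ there exists a compact set $\mathcal{A}_\delta\subseteq[x^\star-\delta,\,x^\star+\delta]$ that is globally asymptotically and locally exponentially stable for $(\ast)$. (b) There exists $\bar\delta^\star>0$ such that, for all $\delta$ with $0<\delta\le\bar\delta^\star$, there exists an equilibrium point $x^\star_{a\delta}\in\operatorname{int}\mathcal{A}_\delta$, where $\mathcal{A}_\delta$ is the set of item (a), that is locally exponentially stable for $(\ast)$. If, in addition, the function $\bar h(s):=h(x^\star+s)-h(x^\star)$ is even, then $x^\star_{a\delta}=x^\star$.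
   Context: Assumption (A1): $h$ is smooth and $x^\star\in\mathbb{R}$ is such that $h(x)-h(x^\star)>0$ for all $x\in\mathbb{R}$ with $x\neq x^\star$. Assumption (A2): $h$ is locally Lipschitz and strictly quasi-convex (i.e. $h(x_1)<h(x_2)$ implies $h(\lambda x_1+(1-\lambda)x_2)<h(x_2)$ for all $\lambda\in(0,1)$), and there exists a class-$\mathcal{K}_\infty$ function $\alpha$ such that $|h(x_2)-h(x_1)|\ge\alpha(|x_2-x_1|)$ for all $x_1,x_2\in\mathbb{R}$ with $(x_1-x^\star)(x_2-x^\star)\ge 0$. A class-$\mathcal{K}_\infty$ function is a continuous, strictly increasing, unbounded function $[0,\infty)\to[0,\infty)$ vanishing at $0$. The system $(\ast)$ is the average of the 1-periodic extremum seeking system $\dot x=-\gamma\,h(x+\delta u(t))\,u(t)$ with $u(t)=\sin(2\pi t)$. Stability of a set is understood with respect to the point-to-set distance. *)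

theory Defs
  imports "HOL-Analysis.Analysis"
begin

definition smooth :: "(real \<Rightarrow> real) \<Rightarrow> bool" where
  "smooth h \<longleftrightarrow> (\<forall>n x. (deriv ^^ n) h differentiable (at x))"

definition locally_lipschitz :: "(real \<Rightarrow> real) \<Rightarrow> bool" where
  "locally_lipschitz h \<longleftrightarrow> (\<forall>x. \<exists>u>0. \<exists>L. L-lipschitz_on (cball x u) h)"

definition strictly_quasiconvex :: "(real \<Rightarrow> real) \<Rightarrow> bool" where
  "strictly_quasiconvex h \<longleftrightarrow>
     (\<forall>x1 x2. h x1 < h x2 \<longrightarrow>
        (\<forall>l\<in>{0<..<1}. h (l * x1 + (1 - l) * x2) < h x2))"

text \<open>Functions of class K-infinity are maps from the nonnegative reals to themselves; as total
  functions on the reals they are constrained on \<open>{0..}\<close> only.\<close>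

definition class_Kinf :: "(real \<Rightarrow> real) \<Rightarrow> bool" where
  "class_Kinf \<alpha> \<longleftrightarrow>
     \<alpha> \<in> {0..} \<rightarrow> {0..} \<and> continuous_on {0..} \<alpha> \<and> strict_mono_on {0..} \<alpha> \<and>
     \<alpha> 0 = 0 \<and> \<not> bounded (\<alpha> ` {0..})"

definition assumption_A1 :: "(real \<Rightarrow> real) \<Rightarrow> real \<Rightarrow> bool" where
  "assumption_A1 h xs \<longleftrightarrow> smooth h \<and> (\<forall>x. x \<noteq> xs \<longrightarrow> h x - h xs > 0)"

definition assumption_A2 :: "(real \<Rightarrow> real) \<Rightarrow> real \<Rightarrow> bool" where
  "assumption_A2 h xs \<longleftrightarrow>
     locally_lipschitz h \<and> strictly_quasiconvex h \<and>
     (\<exists>\<alpha>. class_Kinf \<alpha> \<and>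
        (\<forall>x1 x2. (x1 - xs) * (x2 - xs) \<ge> 0 \<longrightarrow> \<bar>h x2 - h x1\<bar> \<ge> \<alpha> \<bar>x2 - x1\<bar>))"

definition b1 :: "(real \<Rightarrow> real) \<Rightarrow> real \<Rightarrow> real \<Rightarrow> real" where
  "b1 h \<delta> x = 2 * integral {0..1} (\<lambda>t. h (x + \<delta> * sin (2 * pi * t)) * sin (2 * pi * t))"

definition averaged_field :: "(real \<Rightarrow> real) \<Rightarrow> real \<Rightarrow> real \<Rightarrow> real \<Rightarrow> real" where
  "averaged_field h \<gamma> \<delta> x = - (\<gamma> / 2) * b1 h \<delta> x"

definition forward_solution :: "(real \<Rightarrow> real) \<Rightarrow> (real \<Rightarrow> real) \<Rightarrow> bool" where
  "forward_solution f x \<longleftrightarrow>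
     (\<forall>t\<ge>0. (x has_real_derivative f (x t)) (at t within {0..}))"

text \<open>Both stability notions require that solutions exist for all \<open>t \<ge> 0\<close> from the initial
  conditions they speak about: otherwise the estimates, which range over such solutions, would
  hold vacuously in case of finite escape. They also require \<open>A \<noteq> {}\<close>, because
  \<open>infdist x {} = 0\<close> by convention.\<close>

definition globally_asymptotically_stable :: "(real \<Rightarrow> real) \<Rightarrow> real set \<Rightarrow> bool" where
  "globally_asymptotically_stable f A \<longleftrightarrow>
     A \<noteq> {} \<and>
     (\<forall>x0. \<exists>x. forward_solution f x \<and> x 0 = x0) \<and>
     (\<forall>\<epsilon>>0. \<exists>d>0. \<forall>x. forward_solution f x \<and> infdist (x 0) A < d \<longrightarrow>
        (\<forall>t\<ge>0. infdist (x t) A < \<epsilon>)) \<and>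
     (\<forall>x. forward_solution f x \<longrightarrow> ((\<lambda>t. infdist (x t) A) \<longlongrightarrow> 0) at_top)"

definition locally_exponentially_stable :: "(real \<Rightarrow> real) \<Rightarrow> real set \<Rightarrow> bool" where
  "locally_exponentially_stable f A \<longleftrightarrow>
     A \<noteq> {} \<and>
     (\<exists>r>0. \<exists>k>0. \<exists>\<mu>>0.
        (\<forall>x0. infdist x0 A < r \<longrightarrow> (\<exists>x. forward_solution f x \<and> x 0 = x0)) \<and>
        (\<forall>x. forward_solution f x \<and> infdist (x 0) A < r \<longrightarrow>
           (\<forall>t\<ge>0. infdist (x t) A \<le> k * infdist (x 0) A * exp (- \<mu> * t))))"

definition equilibrium :: "(real \<Rightarrow> real) \<Rightarrow> real \<Rightarrow> bool" where
  "equilibrium f xe \<longleftrightarrow> f xe = 0"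

definition hbar :: "(real \<Rightarrow> real) \<Rightarrow> real \<Rightarrow> real \<Rightarrow> real" where
  "hbar h xs s = h (xs + s) - h xs"

end

theory Submission
  imports Defs
begin

text \<open>
  Write \<open>g = h'\<close>, \<open>b = b\<^sub>1\<^sub>,\<^sub>\<delta>\<close> and let \<open>\<langle>G(s)\<rangle>\<close> be the mean of \<open>G (sin (2 \<pi> t))\<close> over
  \<open>0 \<le> t \<le> 1\<close>. Strict quasi-convexity and the strict minimum at \<open>x\<^sup>\<star>\<close> make \<open>h\<close> strictly
  decreasing to the left of \<open>x\<^sup>\<star>\<close> and strictly increasing to the right, so \<open>g\<close> has the sign of
  \<open>y - x\<^sup>\<star>\<close> up to zeros, and its zeros contain no interval. Everything follows from weighted means
  of \<open>g\<close>. Integration by parts and differentiation under the integral give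
  \<open>b(x) = 2 \<delta> \<langle>g(x + \<delta> s) (1 - s\<^sup>2)\<rangle>\<close> and \<open>b'(x) = 2 \<langle>g(x + \<delta> s) s\<rangle>\<close>.

  For \<open>\<bar>x - x\<^sup>\<star>\<bar> \<ge> \<delta>\<close> the dither never crosses \<open>x\<^sup>\<star>\<close>, so the first formula shows that
  \<open>b(x)\<close> has the sign of \<open>x - x\<^sup>\<star>\<close> (\<open>b1_pos_right\<close>, \<open>b1_neg_left\<close>). The averaged
  field thus points into \<open>A\<^sub>\<delta> = [x\<^sup>\<star> - \<delta>, x\<^sup>\<star> + \<delta>]\<close> and, being continuous, does so with speed
  bounded away from zero on every bounded set outside its interior. On such a set the speed dominates a multiple of the
  distance to \<open>A\<^sub>\<delta>\<close>, which makes the distance decay exponentially; this is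
  \<open>inward_field_stable\<close> and settles (a).

  For (b), \<open>b\<close> changes sign on \<open>A\<^sub>\<delta>\<close> and so has a zero \<open>x\<close> in its interior. The point is that
  \<open>b'(x) > 0\<close> there, for every \<open>\<delta> > 0\<close> and even if \<open>h''(x\<^sup>\<star>) = 0\<close>, so any upper bound on \<open>\<delta>\<close>
  will do. Let \<open>a = (x\<^sup>\<star> - x) / \<delta>\<close>, the value of \<open>s\<close> at which \<open>x + \<delta> s\<close> crosses \<open>x\<^sup>\<star>\<close>.
  Since \<open>\<langle>g(x + \<delta> s) (1 - s\<^sup>2)\<rangle> = 0\<close>, a multiple of this weight may be added to the weight
  \<open>s\<close> freely, and the combination
  \<open>(1 - a\<^sup>2) s - a (1 - s\<^sup>2) = (s - a) (1 + a s)\<close>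
  changes sign on \<open>[-1, 1]\<close> exactly where \<open>g(x + \<delta> s)\<close> does. Hence
  \<open>(1 - a\<^sup>2) \<langle>g(x + \<delta> s) s\<rangle> = \<langle>g(x + \<delta> s) (s - a) (1 + a s)\<rangle> > 0\<close>
  (\<open>slope_at_zero_of_b1_pos\<close>). An equilibrium with negative derivative of the field is locally
  exponentially stable (\<open>hyperbolic_equilibrium_stable\<close>). If \<open>h\<close> is even about \<open>x\<^sup>\<star>\<close>, the
  substitution \<open>t \<mapsto> 1 - t\<close> shows \<open>b(x\<^sup>\<star>) = 0\<close>, and this zero can be taken.

  The stability notions also ask for solutions on all of \<open>[0, \<infinity>)\<close>. They come from Banach's fixed
  point theorem for a field made globally Lipschitz by freezing it outside a trapping interval.
\<close>

section \<open>Scalar ordinary differential equations\<close>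

lemma integral_upto_has_real_derivative:
  fixes g :: "real \<Rightarrow> real"
  assumes "continuous_on {0..} g" and "t \<ge> 0"
  shows "((\<lambda>u. integral {0..u} g) has_real_derivative g t) (at t within {0..})"
proof -
  have "continuous_on {0..t+1} g"
    using assms(1) by (rule continuous_on_subset) auto
  hence "((\<lambda>u. integral {0..u} g) has_real_derivative g t) (at t within {0..t+1})"
    by (rule integral_has_real_derivative) (use assms(2) in auto)
  moreover have "at t within {0..t+1} = at t within {0..}"
    by (rule at_within_nhd[of _ "{..<t+1}"]) auto
  ultimately show ?thesis by simp
qed

text \<open>The estimate behind both the boundedness and the contraction of the Picard operator in the norm
  weighted by \<open>exp (- c t)\<close>: a source of size \<open>B\<close> in that norm integrates to at most \<open>B / c\<close>.\<close>

lemma integral_exp_weighted_bound: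
  fixes G :: "real \<Rightarrow> real"
  assumes cont: "continuous_on {0..} G"
    and bound: "\<And>s. s \<ge> 0 \<Longrightarrow> \<bar>G s\<bar> \<le> B * exp (c * s)"
    and "c > 0" "t \<ge> 0"
  shows "\<bar>exp (- (c * t)) * integral {0..t} G\<bar> \<le> B / c"
proof -
  have B: "B \<ge> 0" using bound[of 0] by simp
  have i: "((\<lambda>s. B * exp (c * s)) has_integral (B / c * exp (c * t) - B / c * exp (c * 0))) {0..t}"
    by (rule fundamental_theorem_of_calculus[OF \<open>t \<ge> 0\<close>])
      (use \<open>c > 0\<close> in \<open>auto intro!: derivative_eq_intros
         simp: has_real_derivative_iff_has_vector_derivative[symmetric]\<close>)
  have "\<bar>integral {0..t} G\<bar> \<le> integral {0..t} (\<lambda>s. B * exp (c * s))"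
    unfolding real_norm_def[symmetric]
  proof (rule integral_norm_bound_integral)
    show "G integrable_on {0..t}"
      by (rule integrable_continuous_real, rule continuous_on_subset[OF cont]) auto
    show "(\<lambda>s. B * exp (c * s)) integrable_on {0..t}"
      using i by blast
  qed (use bound in auto)
  also have "\<dots> = B / c * exp (c * t) - B / c"
    using integral_unique[OF i] by simp
  also have "\<dots> \<le> B / c * exp (c * t)"
    using B \<open>c > 0\<close> by simp
  finally show ?thesis
    by (simp add: abs_mult exp_minus field_simps)
qed

text \<open>Picard iteration in Bielecki's weighted norm, where it contracts on the whole half-line at once
  and no local solutions have to be glued. The unknown is \<open>z t = exp (- c t) (x t - x0)\<close>, a
  bounded continuous function; the rate \<open>c = 2 K\<close> gives the contraction factor \<open>K / c = 1 / 2\<close>.\<close>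

lemma global_solution_of_lipschitz:
  fixes F :: "real \<Rightarrow> real"
  assumes lip: "L-lipschitz_on UNIV F"
  shows "\<exists>x. forward_solution F x \<and> x 0 = x0"
proof -
  \<comment> \<open>A Lipschitz constant \<open>L\<close> may be zero, but the weight needs a positive rate.\<close>
  define K where "K = L + 1"
  have "L \<ge> 0" using lip by (rule lipschitz_on_nonneg)
  hence K: "K > 0" by (simp add: K_def)
  have FL: "\<bar>F u - F v\<bar> \<le> K * \<bar>u - v\<bar>" for u v
  proof -
    have "\<bar>F u - F v\<bar> \<le> L * \<bar>u - v\<bar>"
      using lipschitz_onD[OF lip, of u v] by (simp add: dist_real_def)
    also have "\<dots> \<le> K * \<bar>u - v\<bar>"
      by (rule mult_right_mono) (auto simp: K_def)
    finally show ?thesis .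
  qed
  have Fcont: "continuous_on UNIV F"
    using lip by (rule lipschitz_on_continuous_on)
  define c where "c = 2 * K"
  have c: "c > 0" using K by (simp add: c_def)
  define G where "G z s = F (x0 + exp (c * s) * apply_bcontfun z s)" for z s
  have Gcont: "continuous_on S (G z)" for S z
    unfolding G_def by (rule continuous_on_compose2[OF Fcont]) (auto intro!: continuous_intros)
  \<comment> \<open>Bounded continuous functions live on the whole line; \<open>max 0 t\<close> extends the operator to
    negative times by its value at 0.\<close>
  define P where "P z t = exp (- (c * max 0 t)) * integral {0..max 0 t} (G z)" for z t
  have Pcont: "continuous_on UNIV (P z)" for z
  proof -
    have "continuous_on {0..} (\<lambda>u. integral {0..u} (G z))"
      using integral_upto_has_real_derivative[OF Gcont, of _ z]
      by (intro DERIV_continuous_on) auto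
    hence "continuous_on UNIV (\<lambda>t::real. integral {0..max 0 t} (G z))"
      by (rule continuous_on_compose2) (auto intro!: continuous_intros)
    thus ?thesis unfolding P_def by (intro continuous_intros)
  qed
  have Pbound: "\<bar>P z t\<bar> \<le> (\<bar>F x0\<bar> + K * norm z) / c" for z t
    unfolding P_def
  proof (rule integral_exp_weighted_bound[OF Gcont _ c])
    fix s :: real assume s: "s \<ge> 0"
    have "\<bar>G z s - F x0\<bar> \<le> K * \<bar>exp (c * s) * apply_bcontfun z s\<bar>"
      using FL[of "x0 + exp (c * s) * apply_bcontfun z s" x0] by (simp add: G_def)
    also have "\<dots> \<le> K * (exp (c * s) * norm z)"
      using K norm_bounded[of z s] by (simp add: abs_mult)
    finally have "\<bar>G z s\<bar> \<le> \<bar>F x0\<bar> * 1 + K * (exp (c * s) * norm z)" by linarith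
    also have "\<dots> \<le> \<bar>F x0\<bar> * exp (c * s) + K * (exp (c * s) * norm z)"
      using s c by (intro add_right_mono mult_left_mono) auto
    finally show "\<bar>G z s\<bar> \<le> (\<bar>F x0\<bar> + K * norm z) * exp (c * s)"
      by (simp add: algebra_simps)
  qed auto
  have PC: "P z \<in> bcontfun" for z
    by (rule bcontfun_normI[OF Pcont]) (use Pbound in auto)
  have Papp: "apply_bcontfun (Bcontfun (P z)) = P z" for z
    by (rule Bcontfun_inverse[OF PC])
  have contr: "dist (Bcontfun (P z)) (Bcontfun (P w)) \<le> 1/2 * dist z w" for z w
  proof (rule dist_bound)
    fix t :: real
    have "\<bar>exp (- (c * max 0 t)) * integral {0..max 0 t} (\<lambda>s. G z s - G w s)\<bar> \<le> (K * dist z w) / c"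
    proof (rule integral_exp_weighted_bound[OF _ _ c])
      fix s :: real assume "s \<ge> 0"
      have "\<bar>G z s - G w s\<bar> \<le> K * \<bar>exp (c * s) * (apply_bcontfun z s - apply_bcontfun w s)\<bar>"
        using FL[of "x0 + exp (c * s) * apply_bcontfun z s" "x0 + exp (c * s) * apply_bcontfun w s"]
        by (simp add: G_def algebra_simps)
      also have "\<dots> \<le> K * (exp (c * s) * dist z w)"
        using K dist_bounded[of z s w] by (simp add: abs_mult dist_real_def)
      finally show "\<bar>G z s - G w s\<bar> \<le> K * dist z w * exp (c * s)"
        by (simp add: algebra_simps)
    qed (auto intro!: continuous_intros Gcont)
    also have "integral {0..max 0 t} (\<lambda>s. G z s - G w s)
        = integral {0..max 0 t} (G z) - integral {0..max 0 t} (G w)"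
      by (intro integral_diff integrable_continuous_real Gcont)
    finally show "dist (apply_bcontfun (Bcontfun (P z)) t) (apply_bcontfun (Bcontfun (P w)) t) \<le> 1/2 * dist z w"
      using K by (simp add: Papp P_def dist_real_def c_def algebra_simps)
  qed
  have "\<exists>!z. Bcontfun (P z) = z"
    by (rule banach_fix_type[of "1/2"]) (use contr in auto)
  then obtain z where z: "Bcontfun (P z) = z" by blast
  define x where "x t = x0 + exp (c * t) * apply_bcontfun z t" for t
  have GF: "G z = (\<lambda>s. F (x s))" by (simp add: G_def x_def fun_eq_iff)
  have xI: "x t = x0 + integral {0..t} (G z)" if "t \<ge> 0" for t
  proof -
    have "apply_bcontfun z t = exp (- (c * t)) * integral {0..t} (G z)"
      using Papp[of z] that unfolding z by (simp add: P_def)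
    thus ?thesis by (simp add: x_def exp_minus)
  qed
  have "forward_solution F x"
    unfolding forward_solution_def
  proof (intro allI impI)
    fix t :: real assume t: "0 \<le> t"
    have "((\<lambda>t. x0 + integral {0..t} (G z)) has_real_derivative F (x t)) (at t within {0..})"
      using DERIV_add[OF DERIV_const[of x0] integral_upto_has_real_derivative[OF Gcont[of _ z] t]]
      by (simp add: GF)
    thus "(x has_real_derivative F (x t)) (at t within {0..})"
      by (rule has_field_derivative_transform_within[OF _ zero_less_one]) (use t xI in auto)
  qed
  moreover have "x 0 = x0" using xI[of 0] by simp
  ultimately show ?thesis by blast
qed

text \<open>A function that crosses the level \<open>c\<close> must increase somewhere just above it. Only the strip
  between \<open>c\<close> and \<open>c'\<close> matters, since by continuity the function cannot jump over it; this lets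
  the lemma use information on a field near a set only.\<close>

lemma stays_below_barrier:
  fixes \<phi> \<phi>' :: "real \<Rightarrow> real"
  assumes d: "\<And>t. t \<ge> 0 \<Longrightarrow> (\<phi> has_real_derivative \<phi>' t) (at t within {0..})"
    and decr: "\<And>t. t \<ge> 0 \<Longrightarrow> c < \<phi> t \<Longrightarrow> \<phi> t < c' \<Longrightarrow> \<phi>' t \<le> 0"
    and "c < c'" "\<phi> 0 \<le> c" "T \<ge> 0"
  shows "\<phi> T \<le> c"
proof (rule ccontr)
  assume "\<not> \<phi> T \<le> c"
  hence T: "\<phi> T > c" by simp
  have cont: "continuous_on {0..} \<phi>"
    using d by (intro DERIV_continuous_on) auto
  define S where "S = {0..T} \<inter> \<phi> -` {..c}"
  have "closed S"
    unfolding S_def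
    by (rule continuous_closed_preimage[OF continuous_on_subset[OF cont]]) auto
  moreover have "bounded S" by (rule bounded_subset[OF bounded_closed_interval[of 0 T]]) (auto simp: S_def)
  ultimately have "compact S" by (simp add: compact_eq_bounded_closed)
  moreover have "0 \<in> S" using assms by (auto simp: S_def)
  \<comment> \<open>\<open>s\<close> is the last time before \<open>T\<close> at which \<open>\<phi>\<close> is still at most \<open>c\<close>.\<close>
  ultimately obtain s where s: "s \<in> S" "\<And>t. t \<in> S \<Longrightarrow> t \<le> s"
    using compact_attains_sup[of S] by auto
  have above: "\<phi> t > c" if "s < t" "t \<le> T" for t
    using s(1) s(2)[of t] that by (force simp: S_def)
  have s0: "0 \<le> s" "\<phi> s \<le> c" "s < T"
    using s(1) T by (auto simp: S_def less_le)
  have "\<forall>\<^sub>F t in at s within {0..}. \<phi> t < c'"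
    using cont s0 \<open>c < c'\<close> by (intro order_tendstoD(2)[of _ "\<phi> s"]) (auto simp: continuous_on_def)
  then obtain e where e: "e > 0" "\<And>t. t \<ge> 0 \<Longrightarrow> t \<noteq> s \<Longrightarrow> dist t s < e \<Longrightarrow> \<phi> t < c'"
    unfolding eventually_at by auto
  define u where "u = min T (s + e / 2)"
  have u: "s < u" "u \<le> T" "u < s + e" using s0 e by (auto simp: u_def)
  have "\<exists>z\<in>{s<..<u}. \<phi> u - \<phi> s = (*) (\<phi>' z) (u - s)"
  proof (rule mvt_simple[OF u(1)])
    fix t assume "s \<le> t" "t \<le> u"
    hence "(\<phi> has_real_derivative \<phi>' t) (at t within {s..u})"
      using s0 by (intro DERIV_subset[OF d]) auto
    thus "(\<phi> has_derivative (*) (\<phi>' t)) (at t within {s..u})"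
      by (simp add: has_field_derivative_def)
  qed
  then obtain z where z: "s < z" "z < u" "\<phi> u - \<phi> s = \<phi>' z * (u - s)" by auto
  have "\<phi>' z \<le> 0"
    using z u s0 above[of z] e(2)[of z] by (intro decr) (auto simp: dist_real_def)
  hence "\<phi>' z * (u - s) \<le> 0" using u by (simp add: mult_nonpos_nonneg)
  with z s0 above[of u] u show False by auto
qed

text \<open>Reflection lets every one-sided estimate from above serve from below as well.\<close>

lemma forward_solution_reflect:
  assumes "forward_solution f x"
  shows "forward_solution (\<lambda>y. - f (- y)) (\<lambda>t. - x t)"
  using assms unfolding forward_solution_def by (auto intro!: derivative_eq_intros)

lemma forward_solution_stays_below:
  assumes x: "forward_solution f x" and "c < c'" "\<And>y. c < y \<Longrightarrow> y < c' \<Longrightarrow> f y \<le> 0"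
    and "x 0 \<le> c" "t \<ge> 0"
  shows "x t \<le> c"
proof (rule stays_below_barrier[where \<phi> = x and \<phi>' = "\<lambda>t. f (x t)"])
  show "(x has_real_derivative f (x s)) (at s within {0..})" if "s \<ge> 0" for s
    using x that by (simp add: forward_solution_def)
  show "f (x s) \<le> 0" if "c < x s" "x s < c'" for s
    using that by (rule assms(3))
qed (use assms in auto)

text \<open>Freezing the field outside \<open>{m..M}\<close> makes it globally Lipschitz; the frozen field still does
  not point outwards at the ends, so its solutions never see the modification.\<close>

lemma global_solution_in_trapping_interval:
  fixes f :: "real \<Rightarrow> real"
  assumes lip: "L-lipschitz_on {m..M} f"
    and ends: "f m \<ge> 0" "f M \<le> 0" and x0: "x0 \<in> {m..M}"
  shows "\<exists>x. forward_solution f x \<and> x 0 = x0"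
proof -
  define F where "F y = f (max m (min M y))" for y
  have mM: "m \<le> M" using x0 by simp
  have "L-lipschitz_on UNIV F"
  proof (rule lipschitz_onI)
    fix u v :: real
    have "dist (F u) (F v) \<le> L * dist (max m (min M u)) (max m (min M v))"
      unfolding F_def using mM by (intro lipschitz_onD[OF lip]) auto
    also have "\<dots> \<le> L * dist u v"
      using lipschitz_on_nonneg[OF lip] by (intro mult_left_mono) (auto simp: dist_real_def)
    finally show "dist (F u) (F v) \<le> L * dist u v" .
  qed (rule lipschitz_on_nonneg[OF lip])
  from global_solution_of_lipschitz[OF this]
  obtain x where x: "forward_solution F x" "x 0 = x0" by blast
  have up: "x t \<le> M" if "t \<ge> 0" for t
    by (rule forward_solution_stays_below[OF x(1), of M "M + 1"])
      (use that x x0 ends mM in \<open>auto simp: F_def\<close>)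
  have lo: "- x t \<le> - m" if "t \<ge> 0" for t
    by (rule forward_solution_stays_below[OF forward_solution_reflect[OF x(1)], of "-m" "-m + 1"])
      (use that x x0 ends mM in \<open>auto simp: F_def min_def max_def\<close>)
  have "F (x t) = f (x t)" if "t \<ge> 0" for t
    using up[OF that] lo[OF that] by (simp add: F_def)
  hence "forward_solution f x"
    using x(1) by (simp add: forward_solution_def)
  with x show ?thesis by blast
qed

section \<open>Stability of intervals for scalar fields\<close>

lemma infdist_interval:
  fixes x lo hi :: real
  assumes "lo \<le> hi"
  shows "infdist x {lo..hi} = max 0 (max (x - hi) (lo - x))"
proof (rule antisym)
  show "infdist x {lo..hi} \<le> max 0 (max (x - hi) (lo - x))"
    by (rule infdist_le2[of "max lo (min hi x)"]) (use assms in \<open>auto simp: dist_real_def\<close>)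
  show "max 0 (max (x - hi) (lo - x)) \<le> infdist x {lo..hi}"
    using assms by (auto simp: infdist_notempty dist_real_def intro!: cINF_greatest)
qed

text \<open>The distance of \<open>x\<close> above \<open>hi\<close>, multiplied by \<open>exp (\<mu> t)\<close>, cannot grow while it is positive.
  The linear bound on the field holds only up to \<open>hi + r\<close>, so the solution is first confined below
  \<open>hi + r\<close>, using that the field is nonpositive there.\<close>

lemma decay_above:
  assumes x: "forward_solution f x"
    and f: "\<And>y. hi < y \<Longrightarrow> y < hi + r \<Longrightarrow> f y \<le> - \<mu> * (y - hi)"
    and "\<mu> > 0" "r > 0" "x 0 < hi + r" "t \<ge> 0"
  shows "x t - hi \<le> max 0 (x 0 - hi) * exp (- \<mu> * t)"
proof -
  have near: "x s < hi + r" if "s \<ge> 0" for s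
  proof -
    have "x s \<le> max hi (x 0)"
    proof (rule forward_solution_stays_below[OF x _ _ _ that])
      show "max hi (x 0) < hi + r" using assms by auto
      fix y assume y: "max hi (x 0) < y" "y < hi + r"
      hence "f y \<le> - \<mu> * (y - hi)" by (intro f) auto
      also have "\<dots> \<le> 0" using y \<open>\<mu> > 0\<close> by auto
      finally show "f y \<le> 0" .
    qed auto
    thus ?thesis using assms by auto
  qed
  have "(x t - hi) * exp (\<mu> * t) \<le> max 0 (x 0 - hi)"
  proof (rule stays_below_barrier[where \<phi> = "\<lambda>t. (x t - hi) * exp (\<mu> * t)"
        and \<phi>' = "\<lambda>t. (f (x t) + \<mu> * (x t - hi)) * exp (\<mu> * t)"
        and c' = "max 0 (x 0 - hi) + 1"])
    fix s :: real assume s: "0 \<le> s"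
    have dx: "(x has_real_derivative f (x s)) (at s within {0..})"
      using x s by (simp add: forward_solution_def)
    show "((\<lambda>t. (x t - hi) * exp (\<mu> * t)) has_real_derivative
        (f (x s) + \<mu> * (x s - hi)) * exp (\<mu> * s)) (at s within {0..})"
      by (rule derivative_eq_intros dx refl | simp add: algebra_simps)+
    assume "max 0 (x 0 - hi) < (x s - hi) * exp (\<mu> * s)"
    hence "x s > hi" by (auto simp: zero_less_mult_iff)
    from f[OF this near[OF s]]
    show "(f (x s) + \<mu> * (x s - hi)) * exp (\<mu> * s) \<le> 0"
      by (intro mult_nonpos_nonneg) auto
  qed (use assms in auto)
  thus ?thesis by (simp add: exp_minus field_simps)
qed

text \<open>Intervals are allowed to degenerate to a point, so the lemma covers equilibria as well as
  the attracting set of part (a).\<close>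

lemma infdist_interval_decay:
  assumes x: "forward_solution f x" and "lo \<le> hi" "\<mu> > 0" "r > 0"
    and above: "\<And>y. hi < y \<Longrightarrow> y < hi + r \<Longrightarrow> f y \<le> - \<mu> * (y - hi)"
    and below: "\<And>y. lo - r < y \<Longrightarrow> y < lo \<Longrightarrow> f y \<ge> \<mu> * (lo - y)"
    and start: "infdist (x 0) {lo..hi} < r" and t: "t \<ge> 0"
  shows "infdist (x t) {lo..hi} \<le> infdist (x 0) {lo..hi} * exp (- \<mu> * t)"
proof -
  let ?D = "max 0 (max (x 0 - hi) (lo - x 0))"
  have D: "?D < r" using start by (simp add: infdist_interval[OF \<open>lo \<le> hi\<close>])
  have "x t - hi \<le> max 0 (x 0 - hi) * exp (- \<mu> * t)"
    by (rule decay_above[where r = r, OF x above]) (use assms D in auto)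
  also have "\<dots> \<le> ?D * exp (- \<mu> * t)"
    by (rule mult_right_mono) auto
  finally have up: "x t - hi \<le> ?D * exp (- \<mu> * t)" .
  have "- x t - (- lo) \<le> max 0 (- x 0 - (- lo)) * exp (- \<mu> * t)"
  proof (rule decay_above[OF forward_solution_reflect[OF x], where r = r])
    show "- f (- y) \<le> - \<mu> * (y - (- lo))" if "- lo < y" "y < - lo + r" for y
      using below[of "- y"] that by (simp add: algebra_simps)
  qed (use assms D in auto)
  also have "\<dots> \<le> ?D * exp (- \<mu> * t)"
    by (rule mult_right_mono) auto
  finally have "lo - x t \<le> ?D * exp (- \<mu> * t)" by simp
  with up show ?thesis
    by (simp add: infdist_interval[OF \<open>lo \<le> hi\<close>])
qed

lemma locally_exponentially_stable_interval:
  assumes "\<And>x0. \<exists>x. forward_solution f x \<and> x 0 = x0" and "lo \<le> hi" "\<mu> > 0" "r > 0"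
    and "\<And>y. hi < y \<Longrightarrow> y < hi + r \<Longrightarrow> f y \<le> - \<mu> * (y - hi)"
    and "\<And>y. lo - r < y \<Longrightarrow> y < lo \<Longrightarrow> f y \<ge> \<mu> * (lo - y)"
  shows "locally_exponentially_stable f {lo..hi}"
proof -
  have "infdist (x t) {lo..hi} \<le> 1 * infdist (x 0) {lo..hi} * exp (- \<mu> * t)"
    if "forward_solution f x" "infdist (x 0) {lo..hi} < r" "t \<ge> 0" for x t
    using infdist_interval_decay[OF that(1) assms(2,3,4,5,6) that(2,3)] by simp
  with assms(1-4) show ?thesis
    unfolding locally_exponentially_stable_def
    by (intro conjI exI[of _ r] exI[of _ 1] exI[of _ \<mu>]) auto
qed

text \<open>By compactness the field is at most some \<open>- c < 0\<close> on \<open>{hi..hi+r}\<close>, and \<open>y - hi < r\<close>, so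
  the rate \<open>c / r\<close> works.\<close>

lemma linear_rate_of_negative:
  fixes f :: "real \<Rightarrow> real"
  assumes "continuous_on UNIV f" and neg: "\<And>y. y \<ge> hi \<Longrightarrow> f y < 0" and "r > 0"
  obtains \<mu> where "\<mu> > 0" "\<And>y. hi < y \<Longrightarrow> y < hi + r \<Longrightarrow> f y \<le> - \<mu> * (y - hi)"
proof -
  have "continuous_on {hi..hi+r} f"
    using assms(1) continuous_on_subset by blast
  then obtain z where z: "z \<in> {hi..hi+r}" "\<And>y. y \<in> {hi..hi+r} \<Longrightarrow> f y \<le> f z"
    using continuous_attains_sup[of "{hi..hi+r}" f] \<open>r > 0\<close> by auto
  have fz: "f z < 0" using z neg by auto
  show thesis
  proof
    show "- f z / r > 0" using fz \<open>r > 0\<close> by (simp add: divide_neg_pos)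
    fix y assume y: "hi < y" "y < hi + r"
    have "f y \<le> f z" using y by (intro z) auto
    also have "\<dots> = f z * 1" by simp
    also have "\<dots> \<le> f z * ((y - hi) / r)"
      using y fz \<open>r > 0\<close> by (intro mult_left_mono_neg) auto
    finally show "f y \<le> - (- f z / r) * (y - hi)" by simp
  qed
qed

lemma inward_field_rate:
  fixes f :: "real \<Rightarrow> real"
  assumes cont: "continuous_on UNIV f"
    and neg: "\<And>y. y \<ge> hi \<Longrightarrow> f y < 0" and pos: "\<And>y. y \<le> lo \<Longrightarrow> f y > 0" and "r > 0"
  obtains \<mu> where "\<mu> > 0" "\<And>y. hi < y \<Longrightarrow> y < hi + r \<Longrightarrow> f y \<le> - \<mu> * (y - hi)"
    "\<And>y. lo - r < y \<Longrightarrow> y < lo \<Longrightarrow> f y \<ge> \<mu> * (lo - y)"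
proof -
  obtain \<mu>1 where 1: "\<mu>1 > 0" "\<And>y. hi < y \<Longrightarrow> y < hi + r \<Longrightarrow> f y \<le> - \<mu>1 * (y - hi)"
    using linear_rate_of_negative[OF cont neg \<open>r > 0\<close>] by blast
  have c: "continuous_on UNIV (\<lambda>y. - f (- y))"
    by (intro continuous_intros continuous_on_compose2[OF cont]) auto
  have "- f (- y) < 0" if "y \<ge> - lo" for y using pos[of "- y"] that by simp
  then obtain \<mu>2 where 2: "\<mu>2 > 0"
    "\<And>y. - lo < y \<Longrightarrow> y < - lo + r \<Longrightarrow> - f (- y) \<le> - \<mu>2 * (y - (- lo))"
    using linear_rate_of_negative[OF c _ \<open>r > 0\<close>] by blast
  show thesis
  proof
    show "min \<mu>1 \<mu>2 > 0" using 1 2 by simp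
  next
    fix y assume y: "hi < y" "y < hi + r"
    have "min \<mu>1 \<mu>2 * (y - hi) \<le> \<mu>1 * (y - hi)"
      using y by (intro mult_right_mono) auto
    with 1(2)[OF y] show "f y \<le> - min \<mu>1 \<mu>2 * (y - hi)" by linarith
  next
    fix y assume y: "lo - r < y" "y < lo"
    have "min \<mu>1 \<mu>2 * (lo - y) \<le> \<mu>2 * (lo - y)"
      using y by (intro mult_right_mono) auto
    moreover have "\<mu>2 * (lo - y) \<le> f y"
      using 2(2)[of "- y"] y by (simp add: algebra_simps)
    ultimately show "f y \<ge> min \<mu>1 \<mu>2 * (lo - y)" by linarith
  qed
qed

text \<open>A bounded neighbourhood of any size has its own exponential rate. Taking it large enough to
  contain the initial point gives global attraction, even though the rate may degenerate at
  infinity.\<close>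

lemma inward_field_stable:
  fixes f :: "real \<Rightarrow> real"
  assumes ex: "\<And>x0. \<exists>x. forward_solution f x \<and> x 0 = x0" and "lo \<le> hi"
    and cont: "continuous_on UNIV f"
    and neg: "\<And>y. y \<ge> hi \<Longrightarrow> f y < 0" and pos: "\<And>y. y \<le> lo \<Longrightarrow> f y > 0"
  shows "globally_asymptotically_stable f {lo..hi}"
    and "locally_exponentially_stable f {lo..hi}"
proof -
  note rate = inward_field_rate[of f hi lo, OF cont neg pos]
  obtain \<mu> where "\<mu> > 0" "\<And>y. hi < y \<Longrightarrow> y < hi + 1 \<Longrightarrow> f y \<le> - \<mu> * (y - hi)"
    "\<And>y. lo - 1 < y \<Longrightarrow> y < lo \<Longrightarrow> f y \<ge> \<mu> * (lo - y)"
    using rate[of 1] by (metis zero_less_one)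
  thus "locally_exponentially_stable f {lo..hi}"
    using locally_exponentially_stable_interval[OF ex \<open>lo \<le> hi\<close>] by (metis zero_less_one)
  have decay: "\<exists>\<mu>>0. \<forall>t\<ge>0. infdist (x t) {lo..hi} \<le> infdist (x 0) {lo..hi} * exp (- \<mu> * t)"
    if x: "forward_solution f x" for x
  proof -
    define r where "r = infdist (x 0) {lo..hi} + 1"
    have r: "r > 0" "infdist (x 0) {lo..hi} < r"
      using infdist_nonneg[of "x 0" "{lo..hi}"] by (auto simp: r_def)
    obtain \<mu> where \<mu>: "\<mu> > 0" "\<And>y. hi < y \<Longrightarrow> y < hi + r \<Longrightarrow> f y \<le> - \<mu> * (y - hi)"
      "\<And>y. lo - r < y \<Longrightarrow> y < lo \<Longrightarrow> f y \<ge> \<mu> * (lo - y)"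
      using rate[OF _ _ \<open>r > 0\<close>] by blast
    thus ?thesis
      using infdist_interval_decay[OF x \<open>lo \<le> hi\<close> \<mu>(1) r(1) _ _ r(2)] by blast
  qed
  show "globally_asymptotically_stable f {lo..hi}"
    unfolding globally_asymptotically_stable_def
  proof (intro conjI allI impI)
    show "{lo..hi} \<noteq> {}" using \<open>lo \<le> hi\<close> by simp
    show "\<exists>x. forward_solution f x \<and> x 0 = x0" for x0 by (rule ex)
  next
    fix \<epsilon> :: real assume e: "\<epsilon> > 0"
    show "\<exists>d>0. \<forall>x. forward_solution f x \<and> infdist (x 0) {lo..hi} < d \<longrightarrow>
        (\<forall>t\<ge>0. infdist (x t) {lo..hi} < \<epsilon>)"
    proof (intro exI[of _ \<epsilon>] conjI allI impI e; elim conjE)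
      fix x and t :: real
      assume x: "forward_solution f x" "infdist (x 0) {lo..hi} < \<epsilon>" and t: "0 \<le> t"
      obtain \<mu> where \<mu>: "\<mu> > 0" "infdist (x t) {lo..hi} \<le> infdist (x 0) {lo..hi} * exp (- \<mu> * t)"
        using decay[OF x(1)] t by blast
      note \<mu>(2)
      also have "infdist (x 0) {lo..hi} * exp (- \<mu> * t) \<le> infdist (x 0) {lo..hi} * 1"
        using \<mu>(1) t by (intro mult_left_mono infdist_nonneg) auto
      finally show "infdist (x t) {lo..hi} < \<epsilon>" using x(2) by simp
    qed
  next
    fix x assume x: "forward_solution f x"
    obtain \<mu> where \<mu>: "\<mu> > 0"
      "\<And>t. t \<ge> 0 \<Longrightarrow> infdist (x t) {lo..hi} \<le> infdist (x 0) {lo..hi} * exp (- \<mu> * t)"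
      using decay[OF x] by blast
    have "filterlim (\<lambda>t. \<mu> * t) at_top at_top"
      using \<mu>(1) by (intro filterlim_tendsto_pos_mult_at_top[OF tendsto_const _ filterlim_ident])
    hence "((\<lambda>t. exp (- (\<mu> * t))) \<longlongrightarrow> 0) at_top"
      by (intro filterlim_compose[OF exp_at_bot] filterlim_compose[OF filterlim_uminus_at_bot_at_top])
    from tendsto_mult_right_zero[OF this, of "infdist (x 0) {lo..hi}"]
    have lim: "((\<lambda>t. infdist (x 0) {lo..hi} * exp (- \<mu> * t)) \<longlongrightarrow> 0) at_top"
      by simp
    show "((\<lambda>t. infdist (x t) {lo..hi}) \<longlongrightarrow> 0) at_top"
      by (rule tendsto_sandwich[OF _ _ tendsto_const lim])
        (use \<mu>(2) infdist_nonneg in \<open>auto intro: eventually_mono[OF eventually_ge_at_top[of 0]]\<close>)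
  qed
qed

lemma C1_lipschitz_on_interval:
  fixes f f' :: "real \<Rightarrow> real"
  assumes d: "\<And>x. (f has_real_derivative f' x) (at x)" and "continuous_on UNIV f'"
  obtains L where "L-lipschitz_on {m..M} f"
proof -
  have "bounded (f' ` {m..M})"
    using assms(2) by (intro compact_imp_bounded compact_continuous_image)
      (auto intro: continuous_on_subset)
  then obtain B where B: "B > 0" "\<And>y. y \<in> {m..M} \<Longrightarrow> norm (f' y) \<le> B"
    unfolding bounded_pos by auto
  have "norm (f x - f y) \<le> B * norm (x - y)" if "x \<in> {m..M}" "y \<in> {m..M}" for x y
    by (rule field_differentiable_bound[of "{m..M}" f f'])
      (use B that d in \<open>auto intro: has_field_derivative_at_within\<close>)
  hence "B-lipschitz_on {m..M} f"
    using B by (intro lipschitz_onI) (auto simp: dist_norm)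
  thus thesis ..
qed

text \<open>The interval that reaches from the attracting interval to the initial point is a trapping one.\<close>

lemma inward_field_global_solution:
  fixes f f' :: "real \<Rightarrow> real"
  assumes d: "\<And>x. (f has_real_derivative f' x) (at x)" and "continuous_on UNIV f'"
    and neg: "\<And>y. y \<ge> hi \<Longrightarrow> f y < 0" and pos: "\<And>y. y \<le> lo \<Longrightarrow> f y > 0"
  shows "\<exists>x. forward_solution f x \<and> x 0 = x0"
proof -
  obtain L where "L-lipschitz_on {min lo x0..max hi x0} f"
    by (rule C1_lipschitz_on_interval[OF assms(1,2)])
  moreover have "f (min lo x0) \<ge> 0" "f (max hi x0) \<le> 0"
    by (rule less_imp_le, rule pos neg, simp)+
  ultimately show ?thesis
    by (rule global_solution_in_trapping_interval) auto
qed

lemma hyperbolic_equilibrium_stable: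
  fixes f :: "real \<Rightarrow> real"
  assumes ex: "\<And>x0. \<exists>x. forward_solution f x \<and> x 0 = x0"
    and d: "(f has_real_derivative D) (at xe)" and "D < 0" "f xe = 0"
  shows "locally_exponentially_stable f {xe}"
proof -
  have "((\<lambda>y. (f y - f xe) / (y - xe)) \<longlongrightarrow> D) (at xe)"
    using d by (simp add: has_field_derivative_iff)
  hence "\<forall>\<^sub>F y in at xe. (f y - f xe) / (y - xe) < D / 2"
    by (rule order_tendstoD) (use \<open>D < 0\<close> in simp)
  then obtain r where r: "r > 0" "\<And>y. y \<noteq> xe \<Longrightarrow> dist y xe < r \<Longrightarrow> f y / (y - xe) < D / 2"
    unfolding eventually_at using \<open>f xe = 0\<close> by auto
  have "locally_exponentially_stable f {xe..xe}"
  proof (rule locally_exponentially_stable_interval[OF ex, of xe xe "- D / 2" r])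
    fix y
    show "f y \<le> - (- D / 2) * (y - xe)" if "xe < y" "y < xe + r"
      using r(2)[of y] that by (simp add: dist_real_def pos_divide_less_eq)
    show "- D / 2 * (xe - y) \<le> f y" if "xe - r < y" "y < xe"
    proof -
      have "D / 2 * (y - xe) < f y"
        using r(2)[of y] that by (simp add: dist_real_def neg_divide_less_eq)
      thus ?thesis by (simp add: field_simps)
    qed
  qed (use r \<open>D < 0\<close> in auto)
  thus ?thesis by simp
qed


section \<open>The averaged field of a function with a single well\<close>

text \<open>A well may be flat to any order at \<open>xs\<close> and have flat points elsewhere. What its derivative
  \<open>g\<close> always keeps is its sign on either side, and that it vanishes on no interval.\<close>

locale single_well =
  fixes h g :: "real \<Rightarrow> real" and xs :: real
  assumes h_deriv: "(h has_real_derivative g x) (at x)"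
    and g_cont: "continuous_on UNIV g"
    and g_right: "xs \<le> y \<Longrightarrow> 0 \<le> g y"
    and g_left: "y \<le> xs \<Longrightarrow> g y \<le> 0"
    and g_nonzero: "a < b \<Longrightarrow> \<exists>z. a < z \<and> z < b \<and> z \<noteq> xs \<and> g z \<noteq> 0"
begin

definition slope_mean :: "real \<Rightarrow> (real \<Rightarrow> real) \<Rightarrow> real \<Rightarrow> real" where
  "slope_mean \<delta> W x = integral {0..1} (\<lambda>t. g (x + \<delta> * sin (2 * pi * t)) * W (sin (2 * pi * t)))"

lemma h_cont: "continuous_on UNIV h"
  using h_deriv by (intro DERIV_continuous_on) (auto intro: has_field_derivative_at_within)

lemma slope_mean_integrand_cont:
  assumes "continuous_on UNIV W"
  shows "continuous_on {0..1} (\<lambda>t. g (x + \<delta> * sin (2 * pi * t)) * W (sin (2 * pi * t)))"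
  by (intro continuous_intros continuous_on_compose2[OF g_cont] continuous_on_compose2[OF assms]) auto

lemma slope_mean_integrable:
  assumes "continuous_on UNIV W"
  shows "(\<lambda>t. g (x + \<delta> * sin (2 * pi * t)) * W (sin (2 * pi * t))) integrable_on {0..1}"
  by (intro integrable_continuous_real slope_mean_integrand_cont assms)

text \<open>A continuous nonnegative integrand has a positive integral unless it vanishes identically. It
  does not: \<open>g\<close> has a nonzero value in \<open>(x, x + \<delta>)\<close>, which the dither reaches at a time in the
  first quarter of the period.\<close>

lemma slope_mean_pos:
  assumes W: "continuous_on UNIV W" and "\<delta> > 0"
    and nonneg: "\<And>s. \<bar>s\<bar> \<le> 1 \<Longrightarrow> 0 \<le> g (x + \<delta> * s) * W s"
    and nz: "\<And>s. 0 < s \<Longrightarrow> s < 1 \<Longrightarrow> x + \<delta> * s \<noteq> xs \<Longrightarrow> W s \<noteq> 0"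
  shows "slope_mean \<delta> W x > 0"
proof -
  let ?k = "\<lambda>t. g (x + \<delta> * sin (2 * pi * t)) * W (sin (2 * pi * t))"
  have k: "0 \<le> ?k t" for t by (intro nonneg) simp
  obtain z where z: "x < z" "z < x + \<delta>" "z \<noteq> xs" "g z \<noteq> 0"
    using g_nonzero[of x "x + \<delta>"] \<open>\<delta> > 0\<close> by auto
  define s where "s = (z - x) / \<delta>"
  have s: "0 < s" "s < 1" and zs: "z = x + \<delta> * s"
    using z \<open>\<delta> > 0\<close> by (auto simp: s_def)
  define t where "t = arcsin s / (2 * pi)"
  have "arcsin s \<le> pi / 2" by (rule arcsin_ubound) (use s in auto)
  moreover have "0 \<le> arcsin s" by (rule arcsin_nonneg) (use s in auto)
  ultimately have t: "t \<in> {0..1}" using pi_gt_zero by (auto simp: t_def field_simps)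
  have "sin (2 * pi * t) = s" using s by (simp add: t_def)
  hence "?k t \<noteq> 0" using z zs nz[OF s] by simp
  hence "integral {0..1} ?k \<noteq> 0"
    using integral_eq_0_iff[OF slope_mean_integrand_cont[OF W], of x \<delta>] k t by fastforce
  moreover have "integral {0..1} ?k \<ge> 0"
    by (intro integral_nonneg slope_mean_integrable W k)
  ultimately show ?thesis by (simp add: slope_mean_def)
qed

lemma slope_mean_uminus: "slope_mean \<delta> (\<lambda>s. - W s) x = - slope_mean \<delta> W x"
  by (simp add: slope_mean_def)

lemma slope_mean_linear:
  assumes "continuous_on UNIV V" "continuous_on UNIV W"
  shows "slope_mean \<delta> (\<lambda>s. p * V s + q * W s) x = p * slope_mean \<delta> V x + q * slope_mean \<delta> W x"
proof -
  have "slope_mean \<delta> (\<lambda>s. p * V s + q * W s) x = integral {0..1}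
      (\<lambda>t. p * (g (x + \<delta> * sin (2 * pi * t)) * V (sin (2 * pi * t))) +
           q * (g (x + \<delta> * sin (2 * pi * t)) * W (sin (2 * pi * t))))"
    unfolding slope_mean_def by (simp add: algebra_simps)
  also have "\<dots> = p * slope_mean \<delta> V x + q * slope_mean \<delta> W x"
    unfolding slope_mean_def
    by (subst integral_add) (auto intro!: integrable_on_mult_right slope_mean_integrable assms)
  finally show ?thesis .
qed

lemma slope_mean_continuous:
  assumes "continuous_on UNIV W"
  shows "continuous_on UNIV (slope_mean \<delta> W)"
  unfolding slope_mean_def[abs_def] box_real(2)[symmetric] split_def
  by (rule integral_continuous_on_param)
    (auto simp: split_def intro!: continuous_intros continuous_on_compose2[OF g_cont]
       continuous_on_compose2[OF assms])

lemma h_integrand_cont: "continuous_on S (\<lambda>t. h (x + \<delta> * sin (2 * pi * t)) * sin (2 * pi * t))"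
  by (intro continuous_intros continuous_on_compose2[OF h_cont]) auto

text \<open>The function \<open>h (x + \<delta> sin \<theta>) cos \<theta>\<close> is periodic, so its derivative has mean zero.\<close>

lemma b1_by_parts: "b1 h \<delta> x = 2 * \<delta> * slope_mean \<delta> (\<lambda>s. 1 - s\<^sup>2) x"
proof -
  let ?S = "\<lambda>t. sin (2 * pi * t)" and ?C = "\<lambda>t. cos (2 * pi * t)"
  let ?H = "\<lambda>t. h (x + \<delta> * ?S t) * ?S t" and ?G = "\<lambda>t. g (x + \<delta> * ?S t) * (1 - (?S t)\<^sup>2)"
  have dh: "((\<lambda>t. h (x + \<delta> * ?S t)) has_real_derivative g (x + \<delta> * ?S t) * (\<delta> * (?C t * (2 * pi)))) (at t within {0..1})" for t
    by (rule DERIV_chain2[OF h_deriv]) (auto intro!: derivative_eq_intros)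
  have d: "((\<lambda>t. h (x + \<delta> * ?S t) * ?C t) has_real_derivative
      2 * pi * (\<delta> * ?G t - ?H t)) (at t within {0..1})" for t
  proof -
    have "((\<lambda>t. h (x + \<delta> * ?S t) * ?C t) has_real_derivative
        g (x + \<delta> * ?S t) * (\<delta> * (?C t * (2 * pi))) * ?C t + (- ?S t * (2 * pi)) * h (x + \<delta> * ?S t))
        (at t within {0..1})"
      by (rule DERIV_mult[OF dh]) (auto intro!: derivative_eq_intros)
    moreover have sq: "1 - (?S t)\<^sup>2 = ?C t * ?C t"
      by (simp add: cos_squared_eq flip: power2_eq_square)
    have "g (x + \<delta> * ?S t) * (\<delta> * (?C t * (2 * pi))) * ?C t + (- ?S t * (2 * pi)) * h (x + \<delta> * ?S t)
        = 2 * pi * (\<delta> * ?G t - ?H t)"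
      unfolding sq by (simp add: algebra_simps)
    ultimately show ?thesis by simp
  qed
  have "((\<lambda>t. 2 * pi * (\<delta> * ?G t - ?H t)) has_integral (h (x + \<delta> * ?S 1) * ?C 1 - h (x + \<delta> * ?S 0) * ?C 0)) {0..1}"
    by (rule fundamental_theorem_of_calculus)
      (use d in \<open>auto simp: has_real_derivative_iff_has_vector_derivative[symmetric]\<close>)
  from integral_unique[OF this] have "integral {0..1} (\<lambda>t. 2 * pi * (\<delta> * ?G t - ?H t)) = 0"
    by simp
  hence "integral {0..1} (\<lambda>t. \<delta> * ?G t - ?H t) = 0" by simp
  moreover have "integral {0..1} (\<lambda>t. \<delta> * ?G t - ?H t) = \<delta> * integral {0..1} ?G - integral {0..1} ?H"
  proof (subst integral_diff)
    have "?G integrable_on {0..1}"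
      by (rule slope_mean_integrable) (intro continuous_intros)
    thus "(\<lambda>t. \<delta> * ?G t) integrable_on {0..1}" by (rule integrable_on_mult_right)
    show "?H integrable_on {0..1}" by (intro integrable_continuous_real h_integrand_cont)
  qed simp
  ultimately show ?thesis by (simp add: b1_def slope_mean_def)
qed

lemma b1_deriv: "(b1 h \<delta> has_real_derivative 2 * slope_mean \<delta> (\<lambda>s. s) x) (at x)"
proof -
  have "((\<lambda>x. integral (cbox 0 1) (\<lambda>t. h (x + \<delta> * sin (2 * pi * t)) * sin (2 * pi * t)))
      has_real_derivative integral (cbox 0 1) (\<lambda>t. g (x + \<delta> * sin (2 * pi * t)) * sin (2 * pi * t)))
      (at x within UNIV)"
  proof (rule leibniz_rule_field_derivative)
    fix y t :: real
    have "((\<lambda>y. h (y + \<delta> * sin (2 * pi * t))) has_real_derivative g (y + \<delta> * sin (2 * pi * t)) * 1) (at y)"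
      by (rule DERIV_chain2[OF h_deriv]) (auto intro!: derivative_eq_intros)
    from DERIV_cmult_right[OF this, of "sin (2 * pi * t)"]
    show "((\<lambda>y. h (y + \<delta> * sin (2 * pi * t)) * sin (2 * pi * t)) has_real_derivative
        g (y + \<delta> * sin (2 * pi * t)) * sin (2 * pi * t)) (at y within UNIV)" by simp
    show "continuous_on (UNIV \<times> cbox 0 1) (\<lambda>(x, t). g (x + \<delta> * sin (2 * pi * t)) * sin (2 * pi * t))"
      unfolding split_def
      by (intro continuous_intros continuous_on_compose2[OF g_cont]) auto
    show "(\<lambda>t. h (y + \<delta> * sin (2 * pi * t)) * sin (2 * pi * t)) integrable_on cbox 0 1"
      by (intro integrable_continuous h_integrand_cont)
  qed auto
  from DERIV_cmult[OF this, of 2] show ?thesis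
    unfolding b1_def[abs_def] slope_mean_def by simp
qed

text \<open>For these \<open>x\<close> the dither stays on one side of \<open>xs\<close>, where \<open>g\<close> does not change sign.\<close>

lemma b1_pos_right:
  assumes "\<delta> > 0" "x \<ge> xs + \<delta>"
  shows "b1 h \<delta> x > 0"
proof -
  have "slope_mean \<delta> (\<lambda>s. 1 - s\<^sup>2) x > 0"
  proof (rule slope_mean_pos[OF _ \<open>\<delta> > 0\<close>])
    fix s :: real assume s: "\<bar>s\<bar> \<le> 1"
    have "x + \<delta> * s \<ge> xs" using mult_left_mono[of "- 1" s \<delta>] s assms by linarith
    thus "0 \<le> g (x + \<delta> * s) * (1 - s\<^sup>2)"
      using s assms by (intro mult_nonneg_nonneg g_right) (auto simp: abs_square_le_1)
  next
    fix s :: real assume "0 < s" "s < 1"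
    thus "1 - s\<^sup>2 \<noteq> 0" by (simp add: power2_eq_1_iff)
  qed (intro continuous_intros)
  with assms show ?thesis by (simp add: b1_by_parts)
qed

lemma b1_neg_left:
  assumes "\<delta> > 0" "x \<le> xs - \<delta>"
  shows "b1 h \<delta> x < 0"
proof -
  have "slope_mean \<delta> (\<lambda>s. - (1 - s\<^sup>2)) x > 0"
  proof (rule slope_mean_pos[OF _ \<open>\<delta> > 0\<close>])
    fix s :: real assume s: "\<bar>s\<bar> \<le> 1"
    have "x + \<delta> * s \<le> xs" using mult_left_mono[of s 1 \<delta>] s assms by linarith
    thus "0 \<le> g (x + \<delta> * s) * (- (1 - s\<^sup>2))"
      using s assms by (intro mult_nonpos_nonpos g_left) (auto simp: abs_square_le_1)
  next
    fix s :: real assume "0 < s" "s < 1"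
    thus "- (1 - s\<^sup>2) \<noteq> 0" by (simp add: power2_eq_1_iff)
  qed (intro continuous_intros)
  hence "slope_mean \<delta> (\<lambda>s. 1 - s\<^sup>2) x < 0"
    by (simp only: slope_mean_uminus neg_0_less_iff_less)
  with assms show ?thesis by (simp add: b1_by_parts mult_pos_neg)
qed

text \<open>The value \<open>a\<close> of \<open>s\<close> is where \<open>x + \<delta> s\<close> passes through \<open>xs\<close>. At a zero of \<open>b1\<close> the mean
  with weight \<open>1 - s\<^sup>2\<close> vanishes, and subtracting \<open>a\<close> times it from \<open>1 - a\<^sup>2\<close> times the mean with
  weight \<open>s\<close> leaves the weight \<open>(s - a) (1 + a s)\<close>. Its second factor is positive as
  \<open>\<bar>a\<bar> < 1\<close>, so it has the sign of \<open>g (x + \<delta> s)\<close> throughout.\<close>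

lemma slope_at_zero_of_b1_pos:
  assumes "\<delta> > 0" and x: "\<bar>x - xs\<bar> < \<delta>" and zero: "b1 h \<delta> x = 0"
  shows "slope_mean \<delta> (\<lambda>s. s) x > 0"
proof -
  define a where "a = (xs - x) / \<delta>"
  have a: "\<bar>a\<bar> < 1" using x \<open>\<delta> > 0\<close> by (simp add: a_def abs_minus_commute)
  have xa: "x + \<delta> * s - xs = \<delta> * (s - a)" for s
    using \<open>\<delta> > 0\<close> by (simp add: a_def field_simps)
  have fac: "1 + a * s > 0" if "\<bar>s\<bar> \<le> 1" for s
  proof -
    have "\<bar>a * s\<bar> \<le> \<bar>a\<bar> * 1" unfolding abs_mult using that by (intro mult_left_mono) auto
    with a show ?thesis by linarith
  qed
  have "slope_mean \<delta> (\<lambda>s. (s - a) * (1 + a * s)) x > 0"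
  proof (rule slope_mean_pos[OF _ \<open>\<delta> > 0\<close>])
    fix s :: real assume s: "\<bar>s\<bar> \<le> 1"
    have "0 \<le> g (x + \<delta> * s) * (s - a)"
    proof (cases "s \<ge> a")
      case True
      hence "x + \<delta> * s - xs \<ge> 0" unfolding xa using \<open>\<delta> > 0\<close> by simp
      thus ?thesis using True by (intro mult_nonneg_nonneg g_right) auto
    next
      case False
      hence "x + \<delta> * s - xs \<le> 0" unfolding xa using \<open>\<delta> > 0\<close> by (simp add: mult_le_0_iff)
      thus ?thesis using False by (intro mult_nonpos_nonpos g_left) auto
    qed
    with fac[OF s] show "0 \<le> g (x + \<delta> * s) * ((s - a) * (1 + a * s))"
      by (metis less_imp_le mult.assoc mult_nonneg_nonneg)
  next
    fix s :: real assume "0 < s" "s < 1" "x + \<delta> * s \<noteq> xs"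
    thus "(s - a) * (1 + a * s) \<noteq> 0" using xa[of s] fac[of s] by auto
  qed (intro continuous_intros)
  also have "(\<lambda>s. (s - a) * (1 + a * s)) = (\<lambda>s. (1 - a\<^sup>2) * s + (- a) * (1 - s\<^sup>2))"
    by (simp add: fun_eq_iff algebra_simps power2_eq_square)
  also have "slope_mean \<delta> \<dots> x
      = (1 - a\<^sup>2) * slope_mean \<delta> (\<lambda>s. s) x + (- a) * slope_mean \<delta> (\<lambda>s. 1 - s\<^sup>2) x"
    by (intro slope_mean_linear continuous_intros)
  also have "slope_mean \<delta> (\<lambda>s. 1 - s\<^sup>2) x = 0"
    using zero \<open>\<delta> > 0\<close> by (simp add: b1_by_parts)
  finally have "(1 - a\<^sup>2) * slope_mean \<delta> (\<lambda>s. s) x > 0" by simp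
  moreover have "1 - a\<^sup>2 > 0" using a by (simp add: abs_square_less_1)
  ultimately show ?thesis by (simp add: zero_less_mult_iff)
qed

lemma b1_has_zero:
  assumes "\<delta> > 0"
  shows "\<exists>x. \<bar>x - xs\<bar> < \<delta> \<and> b1 h \<delta> x = 0"
proof -
  have "\<exists>x\<ge>xs - \<delta>. x \<le> xs + \<delta> \<and> b1 h \<delta> x = 0"
  proof (rule IVT')
    show "continuous_on {xs - \<delta>..xs + \<delta>} (b1 h \<delta>)"
      using b1_deriv by (intro DERIV_continuous_on) (auto intro: has_field_derivative_at_within)
  qed (use assms b1_pos_right[of \<delta> "xs + \<delta>"] b1_neg_left[of \<delta> "xs - \<delta>"] in auto)
  then obtain x where x: "b1 h \<delta> x = 0" by blast
  hence "\<not> x \<ge> xs + \<delta>" "\<not> x \<le> xs - \<delta>"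
    using b1_pos_right[OF assms, of x] b1_neg_left[OF assms, of x] by auto
  hence "\<bar>x - xs\<bar> < \<delta>" by linarith
  with x show ?thesis by blast
qed

lemma averaged_field_deriv:
  "(averaged_field h \<gamma> \<delta> has_real_derivative - \<gamma> * slope_mean \<delta> (\<lambda>s. s) x) (at x)"
  unfolding averaged_field_def[abs_def]
  using DERIV_cmult[OF b1_deriv[of \<delta> x], of "- (\<gamma> / 2)"] by simp

end

text \<open>The substitution \<open>t \<mapsto> 1 - t\<close> flips the sign of the dither, hence of the whole integrand.\<close>

lemma b1_even_zero:
  assumes even: "\<And>s. hbar h xs (- s) = hbar h xs s"
  shows "b1 h \<delta> xs = 0"
proof -
  let ?k = "\<lambda>t. h (xs + \<delta> * sin (2 * pi * t)) * sin (2 * pi * t)"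
  have k: "?k (1 - t) = - ?k t" for t
  proof -
    have "sin (2 * pi * (1 - t)) = - sin (2 * pi * t)"
      by (simp add: right_diff_distrib sin_diff)
    moreover have "h (xs - \<delta> * sin (2 * pi * t)) = h (xs + \<delta> * sin (2 * pi * t))"
      using even[of "\<delta> * sin (2 * pi * t)"] by (simp add: hbar_def)
    ultimately show ?thesis by simp
  qed
  have "integral {0..1} ?k = 0"
  proof (cases "?k integrable_on {0..1}")
    case True
    then obtain i where i: "(?k has_integral i) {0..1}" by blast
    have "((\<lambda>t. - ?k t) has_integral i) {0..1}"
      using has_integral_affinity[of ?k i 0 1 "- 1" 1] i k by simp
    moreover have "((\<lambda>t. - ?k t) has_integral - i) {0..1}"
      using i by (rule has_integral_neg)
    ultimately have "i = - i" by (rule has_integral_unique)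
    with i show ?thesis by (auto simp: integral_unique)
  qed (rule not_integrable_integral)
  thus ?thesis by (simp add: b1_def)
qed

lemma strictly_quasiconvex_between:
  assumes "strictly_quasiconvex h" "h p < h q" "y \<in> open_segment p q"
  shows "h y < h q"
proof -
  obtain u where u: "0 < u" "u < 1" "y = (1 - u) * p + u * q"
    using assms(3) by (auto simp: in_segment)
  have "h ((1 - u) * p + (1 - (1 - u)) * q) < h q"
    using assms(1,2) u unfolding strictly_quasiconvex_def by (metis diff_gt_0_iff_gt diff_less_eq greaterThanLessThan_iff less_add_same_cancel1)
  thus ?thesis using u by simp
qed

text \<open>Every point between \<open>xs\<close> and \<open>q\<close> has a smaller value of \<open>h\<close> than \<open>q\<close>, so \<open>h\<close> is strictly
  monotone on either side of \<open>xs\<close>. This fixes the sign of the derivative, and by the mean value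
  theorem the derivative cannot vanish on an interval.\<close>

lemma single_well_of_assumptions:
  assumes A1: "assumption_A1 h xs" and A2: "assumption_A2 h xs"
  shows "single_well h (deriv h) xs"
proof -
  have smooth: "(deriv ^^ n) h differentiable (at x)" for n x
    using A1 by (auto simp: assumption_A1_def smooth_def)
  have d: "(h has_real_derivative deriv h x) (at x)" for x
    using smooth[of 0 x] by (simp add: DERIV_deriv_iff_real_differentiable)
  have less: "h y < h q" if "y = xs \<and> q \<noteq> xs \<or> y \<in> open_segment xs q" for y q
  proof -
    have "q \<noteq> xs" using that by auto
    hence "h xs < h q" using A1 by (simp add: assumption_A1_def)
    with that show ?thesis
      using strictly_quasiconvex_between[of h xs q y] A2 by (auto simp: assumption_A2_def)
  qed
  have right: "h y < h q" if "xs \<le> y" "y < q" for y q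
    using that by (intro less) (auto simp: open_segment_eq_real_ivl)
  have left: "h y < h q" if "q < y" "y \<le> xs" for y q
    using that by (intro less) (auto simp: open_segment_eq_real_ivl)
  show ?thesis
  proof
    show "(h has_real_derivative deriv h x) (at x)" for x by (rule d)
    show "continuous_on UNIV (deriv h)"
      using smooth[of 1] by (intro continuous_at_imp_continuous_on ballI)
        (auto intro: differentiable_imp_continuous_within)
  next
    fix y assume y: "xs \<le> y"
    show "0 \<le> deriv h y"
    proof (rule ccontr)
      assume "\<not> 0 \<le> deriv h y"
      then obtain e where e: "e > 0" "\<And>k. 0 < k \<Longrightarrow> k < e \<Longrightarrow> h (y + k) < h y"
        using DERIV_neg_dec_right[OF d[of y]] by auto
      show False using e(2)[of "e / 2"] right[of y "y + e / 2"] y e(1) by auto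
    qed
  next
    fix y assume y: "y \<le> xs"
    show "deriv h y \<le> 0"
    proof (rule ccontr)
      assume "\<not> deriv h y \<le> 0"
      then obtain e where e: "e > 0" "\<And>k. 0 < k \<Longrightarrow> k < e \<Longrightarrow> h (y - k) < h y"
        using DERIV_pos_inc_left[OF d[of y]] by auto
      show False using e(2)[of "e / 2"] left[of "y - e / 2" y] y e(1) by auto
    qed
  next
    fix a b :: real assume "a < b"
    \<comment> \<open>One half of the interval avoids crossing \<open>xs\<close>.\<close>
    have "\<exists>p q. a \<le> p \<and> p < q \<and> q \<le> b \<and> (xs \<le> p \<or> q \<le> xs)"
    proof (cases "xs \<le> (a + b) / 2")
      case True
      thus ?thesis using \<open>a < b\<close> by (intro exI[of _ "(a + b) / 2"] exI[of _ b]) auto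
    next
      case False
      thus ?thesis using \<open>a < b\<close> by (intro exI[of _ a] exI[of _ "(a + b) / 2"]) auto
    qed
    then obtain p q where pq: "a \<le> p" "p < q" "q \<le> b" "xs \<le> p \<or> q \<le> xs" by blast
    obtain z where z: "p < z" "z < q" "h q - h p = (q - p) * deriv h z"
      using MVT2[OF pq(2), of h "deriv h"] d by blast
    have "h p \<noteq> h q" using pq right[of p q] left[of p q] by auto
    with z pq show "\<exists>z. a < z \<and> z < b \<and> z \<noteq> xs \<and> deriv h z \<noteq> 0"
      by (intro exI[of _ z]) auto
  qed
qed

theorem lemma1:
  fixes h :: "real \<Rightarrow> real" and xs \<gamma> :: real
  assumes "assumption_A1 h xs"
    and "assumption_A2 h xs"
    and "\<gamma> > 0"
  shows "\<exists>A :: real \<Rightarrow> real set.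
     (\<forall>\<delta>>0. compact (A \<delta>) \<and> A \<delta> \<subseteq> {xs - \<delta> .. xs + \<delta>} \<and>
        globally_asymptotically_stable (averaged_field h \<gamma> \<delta>) (A \<delta>) \<and>
        locally_exponentially_stable (averaged_field h \<gamma> \<delta>) (A \<delta>)) \<and>
     (\<exists>\<delta>bar>0. \<forall>\<delta>. 0 < \<delta> \<and> \<delta> \<le> \<delta>bar \<longrightarrow>
        (\<exists>xe. equilibrium (averaged_field h \<gamma> \<delta>) xe \<and> xe \<in> interior (A \<delta>) \<and>
           locally_exponentially_stable (averaged_field h \<gamma> \<delta>) {xe} \<and>
           ((\<forall>s. hbar h xs (- s) = hbar h xs s) \<longrightarrow> xe = xs)))"
proof -
  interpret single_well h "deriv h" xs
    using assms(1,2) by (rule single_well_of_assumptions)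
  let ?f = "averaged_field h \<gamma>" and ?A = "\<lambda>\<delta>. {xs - \<delta>..xs + \<delta>}"
  have neg: "?f \<delta> y < 0" if "\<delta> > 0" "y \<ge> xs + \<delta>" for \<delta> y
    using b1_pos_right[OF that] \<open>\<gamma> > 0\<close> by (simp add: averaged_field_def)
  have pos: "?f \<delta> y > 0" if "\<delta> > 0" "y \<le> xs - \<delta>" for \<delta> y
    using b1_neg_left[OF that] \<open>\<gamma> > 0\<close> by (simp add: averaged_field_def mult_pos_neg)
  have slope_cont: "continuous_on UNIV (\<lambda>x. - \<gamma> * slope_mean \<delta> (\<lambda>s. s) x)" for \<delta>
    by (intro continuous_intros slope_mean_continuous)
  have cont: "continuous_on UNIV (?f \<delta>)" for \<delta>
    using averaged_field_deriv by (intro DERIV_continuous_on) auto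
  have ex: "\<exists>x. forward_solution (?f \<delta>) x \<and> x 0 = x0" if "\<delta> > 0" for \<delta> x0
    by (rule inward_field_global_solution[OF averaged_field_deriv slope_cont neg[OF that] pos[OF that]])
  have interval: "globally_asymptotically_stable (?f \<delta>) (?A \<delta>)"
    "locally_exponentially_stable (?f \<delta>) (?A \<delta>)" if "\<delta> > 0" for \<delta>
    using inward_field_stable[OF ex[OF that] _ cont neg[OF that] pos[OF that]] that by auto
  have point: "\<exists>xe. equilibrium (?f \<delta>) xe \<and> xe \<in> interior (?A \<delta>) \<and>
      locally_exponentially_stable (?f \<delta>) {xe} \<and>
      ((\<forall>s. hbar h xs (- s) = hbar h xs s) \<longrightarrow> xe = xs)" if "\<delta> > 0" for \<delta>
  proof -
    obtain xe where xe: "\<bar>xe - xs\<bar> < \<delta>" "b1 h \<delta> xe = 0"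
      "(\<forall>s. hbar h xs (- s) = hbar h xs s) \<longrightarrow> xe = xs"
    proof (cases "\<forall>s. hbar h xs (- s) = hbar h xs s")
      case True
      thus thesis using b1_even_zero[of h xs \<delta>] \<open>\<delta> > 0\<close> by (intro that[of xs]) auto
    next
      case False
      thus thesis using b1_has_zero[OF \<open>\<delta> > 0\<close>] that by blast
    qed
    have eq: "?f \<delta> xe = 0" using xe by (simp add: averaged_field_def)
    have "- \<gamma> * slope_mean \<delta> (\<lambda>s. s) xe < 0"
      using slope_at_zero_of_b1_pos[OF \<open>\<delta> > 0\<close> xe(1,2)] \<open>\<gamma> > 0\<close> by simp
    hence "locally_exponentially_stable (?f \<delta>) {xe}"
      using hyperbolic_equilibrium_stable[OF ex[OF \<open>\<delta> > 0\<close>] averaged_field_deriv _ eq] by blast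
    moreover have "xe \<in> interior (?A \<delta>)"
      using xe(1) by (simp add: interior_atLeastAtMost_real abs_less_iff)
    ultimately show ?thesis using eq xe(3) unfolding equilibrium_def by blast
  qed
  show ?thesis
  proof (intro exI[of _ ?A] conjI allI impI)
    show "\<exists>\<delta>bar>0. \<forall>\<delta>. 0 < \<delta> \<and> \<delta> \<le> \<delta>bar \<longrightarrow>
        (\<exists>xe. equilibrium (?f \<delta>) xe \<and> xe \<in> interior (?A \<delta>) \<and>
           locally_exponentially_stable (?f \<delta>) {xe} \<and>
           ((\<forall>s. hbar h xs (- s) = hbar h xs s) \<longrightarrow> xe = xs))"
      using point zero_less_one by blast
  qed (use interval in auto)
qed

end
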